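(* Let $q$ be an odd prime power with $q\not\equiv 2\pmod 3$ and $q\equiv 3\pmod 4$, and let $d_2=\frac{(q-1)(q+3)}{2}$. Then the boomerang uniformity of the power mapping $F_2(x)=x^{d_2}$ over $\mathrm{GF}(q^2)$ is $2$, i.e. $\beta_{F_2}=2$.
   Context: $\mathrm{GF}(Q)$ denotes the finite field with $Q$ elements and $\mathrm{GF}(Q)^*=\mathrm{GF}(Q)\setminus\{0\}$. For a function $F:\mathrm{GF}(Q)\to\mathrm{GF}(Q)$ and $a,b\in\mathrm{GF}(Q)^*$, let $\beta_F(a,b)$ be the number of solutions $(x,y)\in\mathrm{GF}(Q)\times\mathrm{GF}(Q)$ of the system $F(x)-F(y)=b$, $F(x+a)-F(y+a)=b$. The boomerang uniformity of $F$ is $\beta_F=\max_{a,b\in\mathrm{GF}(Q)^*}\beta_F(a,b)$. Here $Q=q^2$.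
   Formalization: The case q = 3 is excluded: there d_2 = 6 and F_2(x) = x^6 = (x^2)^3 over GF(9) is planar, so its boomerang uniformity is 0, not 2. *)

theory Defs
  imports "HOL-Number_Theory.Number_Theory" "HOL-Library.Cardinality"
begin

definition boomerang_count :: "('a::{field,finite} \<Rightarrow> 'a) \<Rightarrow> 'a \<Rightarrow> 'a \<Rightarrow> nat" where
  "boomerang_count F a b =
     card {(x, y). F x - F y = b \<and> F (x + a) - F (y + a) = b}"

definition boomerang_uniformity :: "('a::{field,finite} \<Rightarrow> 'a) \<Rightarrow> nat" where
  "boomerang_uniformity F = Max {boomerang_count F a b | a b. a \<noteq> 0 \<and> b \<noteq> 0}"

end

theory Submission
  imports Defs "HOL-Computational_Algebra.Polynomial"
begin

text \<open>
  For \<open>x \<noteq> 0\<close> the value \<open>F x\<close> lies in the group \<open>U\<close> of \<open>(q+1)\<close>-th roots of unity, where \<open>u\<^sup>q = 1/u\<close>,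
  and \<open>F x = F y\<close> iff \<open>x/y\<close> lies in \<open>GF(q)\<close>. Applying the Frobenius map to \<open>u + v = w + z \<noteq> 0\<close> with all
  four summands in \<open>U\<close> gives \<open>u v = w z\<close>, so a nonzero sum of two elements of \<open>U\<close> determines them up to
  order. Hence, if \<open>x\<close>, \<open>y\<close>, \<open>x + 1\<close>, \<open>y + 1\<close> are nonzero, the system with \<open>a = 1\<close> forces
  \<open>F (x + 1) = - F y\<close> and \<open>F (y + 1) = - F x\<close>, and a solution is determined by \<open>(F x, F y)\<close>, for
  which there are at most two choices. Zeros are excluded since \<open>q \<noteq> 2 mod 3\<close> means that \<open>U\<close> has no
  primitive sixth roots of unity (in
  characteristic 3 the root \<open>-1\<close> of \<open>t\<^sup>2 - t + 1\<close> is handled directly). For the lower bound, solutions are parametrised by pairs in \<open>GF(q)\<close>,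
  and \<open>(x, y) \<mapsto> (-1 - x, -1 - y)\<close> is a fixed-point-free involution on them.
\<close>

section \<open>Finite-field preliminaries and reduction to shift 1\<close>

lemma power_card_minus_one_eq_one:
  fixes x :: "'a::{field,finite}"
  assumes "x \<noteq> 0"
  shows "x ^ (CARD('a) - 1) = 1"
proof -
  let ?S = "UNIV - {0::'a}"
  have "bij_betw (\<lambda>y. x * y) ?S ?S"
    by (rule bij_betwI[where g = "\<lambda>y. y / x"]) (use assms in auto)
  then have "(\<Prod>y\<in>?S. y) = (\<Prod>y\<in>?S. x * y)"
    using prod.reindex_bij_betw[of "(*) x" ?S ?S id] by simp
  also have "\<dots> = x ^ (CARD('a) - 1) * (\<Prod>y\<in>?S. y)"
    by (simp add: prod.distrib)
  finally show ?thesis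
    by (simp add: prod_zero_iff)
qed

text \<open>A nonzero polynomial of degree at most \<open>n\<close> cannot vanish at all nonzero
  elements. This supplies elements of large enough order without appeal to cyclicity of the
  multiplicative group.\<close>

lemma ex_power_neq_one:
  assumes "0 < n" "n < CARD('a) - 1"
  shows "\<exists>x::'a::{field,finite}. x \<noteq> 0 \<and> x ^ n \<noteq> 1"
proof (rule ccontr)
  assume "\<not> ?thesis"
  then have sub: "UNIV - {0::'a} \<subseteq> {x. x ^ n = 1}" by auto
  let ?p = "monom 1 n - 1 :: 'a poly"
  have "coeff ?p n = 1" using assms by (simp add: coeff_1)
  then have p: "?p \<noteq> 0" by force
  have "degree ?p \<le> n"
    by (rule degree_diff_le) (auto simp: degree_monom_eq)
  with card_poly_roots_bound[OF p] have "card {x. poly ?p x = 0} \<le> n" by linarith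
  also have "{x. poly ?p x = 0} = {x. x ^ n = 1}"
    by (simp add: poly_monom)
  finally have "card (UNIV - {0::'a}) \<le> n"
    using card_mono[OF _ sub] by (meson finite le_trans)
  then show False using assms by simp
qed

text \<open>Dividing \<open>x\<close> and \<open>y\<close> by \<open>a\<close> normalises the shift
  to 1. The inequality suffices because it only carries the upper bound to general
  \<open>a\<close>.\<close>

lemma boomerang_count_power_scale:
  fixes a b :: "'a::{field,finite}"
  assumes "a \<noteq> 0"
  shows "boomerang_count (\<lambda>x. x ^ d) a b \<le> boomerang_count (\<lambda>x. x ^ d) 1 (b / a ^ d)"
  unfolding boomerang_count_def
proof (rule card_inj_on_le)
  let ?g = "\<lambda>(x, y). (x / a, y / a)"
  show "inj_on ?g {(x, y). x ^ d - y ^ d = b \<and> (x + a) ^ d - (y + a) ^ d = b}"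
    using assms by (auto simp: inj_on_def)
  have shift: "x / a + 1 = (x + a) / a" for x :: 'a
    using assms by (simp add: field_simps)
  show "?g ` {(x, y). x ^ d - y ^ d = b \<and> (x + a) ^ d - (y + a) ^ d = b}
      \<subseteq> {(x, y). x ^ d - y ^ d = b / a ^ d \<and> (x + 1) ^ d - (y + 1) ^ d = b / a ^ d}"
    by (auto simp: shift power_divide simp flip: diff_divide_distrib)
qed simp

section \<open>The power map on GF(q^2), with GF(q) encoded as the fixed points
  \<open>x ^ q = x\<close>\<close>

locale quadratic_ext =
  fixes q :: nat and ty :: "'a::{field,finite} itself"
  assumes frob: "\<And>x y :: 'a. (x + y) ^ q = x ^ q + y ^ q"
    and card: "CARD('a) = q ^ 2"
    and q_mod_4: "q mod 4 = 3"
begin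

definition d :: nat where "d = (q - 1) * (q + 3) div 2"

definition F :: "'a \<Rightarrow> 'a" where "F x = x ^ d"

lemma q_ge_3: "q \<ge> 3"
  using q_mod_4 by presburger

text \<open>Splits the exponent: raising to \<open>q - 1\<close> lands in the norm-one group, and
  the other factor, odd since \<open>q mod 4 = 3\<close>, then acts injectively there.\<close>

lemma d_eq: "d = (q - 1) * ((q + 3) div 2)"
proof -
  have "2 dvd q + 3" using q_mod_4 by presburger
  then show ?thesis by (simp add: d_def div_mult_swap)
qed

lemma odd_half: "odd ((q + 3) div 2)"
  using q_mod_4 by presburger

lemma frob_uminus: "(- x :: 'a) ^ q = - (x ^ q)"
  using q_mod_4 by (intro power_minus_odd) presburger

lemma frob_diff: "(x - y :: 'a) ^ q = x ^ q - y ^ q"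
  using frob[of x "- y"] by (simp add: frob_uminus)

lemma card_minus_1: "CARD('a) - 1 = (q - 1) * (q + 1)"
  by (simp add: card power2_eq_square algebra_simps)

lemma power_norm_eq_1:
  assumes "x \<noteq> (0::'a)" shows "(x ^ (q - 1)) ^ (q + 1) = 1"
  using power_card_minus_one_eq_one[OF assms] by (simp only: card_minus_1 power_mult)

lemma power_Suc_q: "(x::'a) ^ q = x * x ^ (q - 1)"
  using q_ge_3 by (simp flip: power_Suc)

lemma subfield_iff: "x \<noteq> (0::'a) \<Longrightarrow> x ^ q = x \<longleftrightarrow> x ^ (q - 1) = 1"
  unfolding power_Suc_q by auto

lemma two_neq_0: "(2::'a) \<noteq> 0"
proof
  assume "(2::'a) = 0"
  then have "CHAR('a) dvd 2"
    using of_nat_eq_0_iff_char_dvd[where 'a = 'a, of 2] by simp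
  moreover have "CHAR('a) dvd CARD('a)" by (rule CHAR_dvd_CARD)
  ultimately have "CHAR('a) dvd gcd 2 (CARD('a))" by simp
  moreover have "odd q" using q_mod_4 by presburger
  then have "gcd 2 (CARD('a)) = 1" by (simp add: card)
  ultimately show False by simp
qed

lemma F_0 [simp]: "F 0 = 0"
  using q_ge_3 by (simp add: F_def d_eq)

lemma F_1 [simp]: "F 1 = 1"
  by (simp add: F_def)

lemma F_mult: "F (x * y) = F x * F y"
  by (simp add: F_def power_mult_distrib)

lemma F_divide: "F (x / y) = F x / F y"
  by (simp add: F_def power_divide)

lemma F_eq_0_iff [simp]: "F x = 0 \<longleftrightarrow> x = 0"
  using F_0 by (auto simp: F_def)

lemma F_subfield:
  assumes "x \<noteq> 0" "x ^ q = x" shows "F x = 1"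
  using assms by (simp add: F_def d_eq power_mult subfield_iff)

text \<open>The exponent \<open>(q + 3) div 2\<close> is odd and its double is
  \<open>(q + 1) + 2\<close>, so it is coprime to \<open>q + 1\<close>; hence only
  \<open>w = 1\<close> in the norm-one group is sent to 1.\<close>

lemma F_eq_1_iff: "F x = 1 \<longleftrightarrow> x \<noteq> 0 \<and> x ^ q = x"
proof (cases "x = 0")
  case False
  define w where "w = x ^ (q - 1)"
  have w: "w ^ (q + 1) = 1" unfolding w_def by (rule power_norm_eq_1[OF False])
  have "w = 1" if "F x = 1"
  proof -
    have e: "w ^ ((q + 3) div 2) = 1"
      using that by (simp add: F_def d_eq power_mult w_def)
    have "2 * ((q + 3) div 2) = (q + 1) + 2" using q_mod_4 by presburger
    then have "w ^ (q + 1) * w ^ 2 = (w ^ ((q + 3) div 2)) ^ 2"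
      by (simp only: flip: power_add power_mult) (simp add: mult.commute)
    then have w2: "w ^ 2 = 1" using w e by simp
    obtain m where "(q + 3) div 2 = 2 * m + 1" using odd_half oddE by blast
    then show "w = 1" using e w2 by (simp add: power_mult power_add)
  qed
  moreover have "x ^ q = x \<longleftrightarrow> w = 1" unfolding w_def by (rule subfield_iff[OF False])
  ultimately show ?thesis using False F_subfield by blast
qed simp

lemma F_uminus [simp]: "F (- x) = F x"
proof -
  have "F (-1) = 1" by (rule F_subfield) (auto simp: frob_uminus)
  then show ?thesis using F_mult[of "-1" x] by simp
qed

lemma F_eq_iff:
  assumes "x \<noteq> 0" "y \<noteq> 0"
  shows "F x = F y \<longleftrightarrow> (x / y) ^ q = x / y"
  using F_eq_1_iff[of "x / y"] assms by (simp add: F_divide)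

section \<open>Norm-one elements and sums of two of them\<close>

definition U :: "'a set" where "U = {u. u ^ q * u = 1}"

lemma F_in_U: "x \<noteq> 0 \<Longrightarrow> F x \<in> U"
proof -
  assume "x \<noteq> 0"
  have "F x ^ q * F x = F x ^ (q + 1)" by (simp add: mult.commute)
  also have "\<dots> = ((x ^ (q - 1)) ^ (q + 1)) ^ ((q + 3) div 2)"
    unfolding F_def d_eq by (simp only: mult_ac flip: power_mult)
  finally show ?thesis using power_norm_eq_1[OF \<open>x \<noteq> 0\<close>] by (simp add: U_def)
qed

lemma U_uminus: "u \<in> U \<Longrightarrow> - u \<in> U"
  by (simp add: U_def frob_uminus)

text \<open>Frobenius inverts \<open>u\<close> and \<open>v\<close>, and multiplying the sum of the
  inverses by \<open>u * v\<close> returns \<open>u + v\<close>.\<close>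

lemma U_sum_mult:
  assumes "u \<in> U" "v \<in> U"
  shows "(u + v) ^ q * (u * v) = u + v"
proof -
  have "(u + v) ^ q * (u * v) = (u ^ q * u) * v + (v ^ q * v) * u"
    unfolding frob by (simp add: algebra_simps)
  then show ?thesis using assms by (simp add: U_def)
qed

lemma U_sum_unique:
  assumes "u \<in> U" "v \<in> U" "w \<in> U" "z \<in> U" "u + v = w + z" "u + v \<noteq> 0"
  shows "u = w \<and> v = z \<or> u = z \<and> v = w"
proof -
  have "(u + v) ^ q * (u * v) = (u + v) ^ q * (w * z)"
    using U_sum_mult[OF assms(1,2)] U_sum_mult[OF assms(3,4)] assms(5) by simp
  then have "u * v = w * z" using assms(6) by simp
  moreover have v: "v = w + z - u" using assms(5) by (simp add: algebra_simps)
  \<comment> \<open>With equal sums and products, \<open>u\<close> is a root of the quadratic with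
    roots \<open>w\<close> and \<open>z\<close>.\<close>
  ultimately have "(u - w) * (u - z) = 0" by (simp add: algebra_simps)
  then show ?thesis using v by auto
qed

text \<open>The quotient \<open>(x + 1) / x\<close>, which is 1 plus the inverse of
  \<open>x\<close>, is fixed by Frobenius, hence so is \<open>x\<close>.\<close>

lemma subfield_of_F_eq_shift:
  assumes "x \<noteq> 0" "x + 1 \<noteq> 0" "F x = F (x + 1)"
  shows "x ^ q = x"
proof -
  have "((x + 1) / x) ^ q = (x + 1) / x" using assms F_eq_iff[of "x + 1" x] by simp
  moreover have "(x + 1) / x = 1 + inverse x" using assms by (simp add: field_simps)
  ultimately have "inverse x ^ q = inverse x" by (simp add: frob)
  then show ?thesis by (metis inverse_inverse_eq power_inverse)
qed

lemma F_eq_1_of_eq_shift: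
  assumes "x \<noteq> 0" "x + 1 \<noteq> 0" "F x = F (x + 1)"
  shows "F x = 1"
  by (rule F_subfield[OF assms(1) subfield_of_F_eq_shift[OF assms]])

section \<open>Lower bound: two explicit solutions\<close>

lemma ex_sqrt_minus_one: "\<exists>i::'a. i ^ 2 = -1 \<and> i ^ q = - i \<and> F i = -1"
proof -
  obtain m where m: "q = 4 * m + 3"
    using q_mod_4 by (metis mult_div_mod_eq)
  \<comment> \<open>A quarter of the group order \<open>q^2 - 1\<close>, so \<open>z ^ n\<close> has
    fourth power 1, and the choice of \<open>z\<close> keeps its square from being 1.\<close>
  define n where "n = (2 * m + 1) * (2 * m + 2)"
  have card_n: "CARD('a) - 1 = n * 2 * 2" unfolding card_minus_1 n_def m by (simp add: algebra_simps)
  have "n > 0" by (simp add: n_def)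
  then have "0 < n * 2" "n * 2 < CARD('a) - 1" unfolding card_n by simp_all
  then obtain z :: 'a where z: "z \<noteq> 0" "z ^ (n * 2) \<noteq> 1"
    using ex_power_neq_one by blast
  define i where "i = z ^ n"
  have "(i ^ 2) ^ 2 = 1"
    using power_card_minus_one_eq_one[OF z(1)] unfolding card_n i_def by (simp only: power_mult)
  moreover have "i ^ 2 \<noteq> 1" using z(2) unfolding i_def by (simp only: power_mult not_False_eq_True)
  ultimately have i2: "i ^ 2 = -1" using power2_eq_1_iff by blast
  then have i4: "i ^ 4 = 1" using power_mult[of i 2 2] by simp
  \<comment> \<open>Here \<open>q - 1 = 4 * m + 2\<close>, so this power equals
    \<open>i ^ 2\<close>.\<close>
  have iq: "i ^ (q - 1) = -1"
    using i2 i4 by (simp add: m power_add power_mult flip: power2_eq_square)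
  have "i ^ q = - i" using iq by (simp add: power_Suc_q)
  moreover have "F i = -1" unfolding F_def d_eq power_mult iq using odd_half by simp
  ultimately show ?thesis using i2 by blast
qed

text \<open>The norm \<open>w ^ (q + 1)\<close> lies in GF(q), and \<open>w\<close> is chosen so
  that its norm does not square to 1. For \<open>q = 3\<close> the fixed field is just 0, 1,
  -1.\<close>

lemma ex_subfield_elem:
  assumes "q \<noteq> 3"
  shows "\<exists>s::'a. s ^ q = s \<and> s \<noteq> 0 \<and> s \<noteq> 1 \<and> s \<noteq> -1"
proof -
  have "q > 3" using assms q_ge_3 by simp
  then have "(q + 1) * 2 < (q + 1) * (q - 1)" by (subst mult_less_cancel1) simp
  then obtain w :: 'a where w: "w \<noteq> 0" "w ^ ((q + 1) * 2) \<noteq> 1"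
    using ex_power_neq_one[where 'a = 'a, of "(q + 1) * 2"]
    unfolding card_minus_1 mult.commute[of "q - 1"] by (auto simp del: power_Suc mult_Suc mult_Suc_right)
  have "(w ^ (q + 1)) ^ (q - 1) = 1"
    using power_norm_eq_1[OF w(1)] by (simp only: mult.commute flip: power_mult)
  then have "(w ^ (q + 1)) ^ q = w ^ (q + 1)" using subfield_iff w(1) by simp
  moreover have "(w ^ (q + 1)) ^ 2 \<noteq> 1" using w(2) by (simp only: power_mult not_False_eq_True)
  then have "w ^ (q + 1) \<noteq> 1" "w ^ (q + 1) \<noteq> -1" unfolding power2_eq_1_iff by blast+
  ultimately show ?thesis using w(1) by (intro exI[of _ "w ^ (q + 1)"]) simp
qed

lemma boomerang_count_ge_2:
  assumes "q \<noteq> 3"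
  shows "\<exists>b. b \<noteq> 0 \<and> 2 \<le> boomerang_count F 1 b"
proof -
  obtain i :: 'a where i2: "i ^ 2 = -1" and iq: "i ^ q = - i" and Fi: "F i = -1"
    using ex_sqrt_minus_one by blast
  obtain s :: 'a where sq: "s ^ q = s" and s: "s \<noteq> 0" "s \<noteq> 1" "s \<noteq> -1"
    using ex_subfield_elem[OF assms] by blast
  have i_notin: "i ^ q \<noteq> i"
  proof
    assume "i ^ q = i"
    then have "i = - i" using iq by (rule trans[OF sym])
    then have "2 * i = 0" unfolding mult_2 by (simp only: eq_neg_iff_add_eq_0)
    then show False using two_neq_0 i2 by auto
  qed
  have s1: "s + 1 \<noteq> 0" using s(3) by (simp add: eq_neg_iff_add_eq_0)
  have s1q: "(s + 1) ^ q = s + 1" by (simp add: frob sq)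
  have Fs: "F s = 1" and Fs1: "F (s + 1) = 1" using F_subfield s s1 sq s1q by blast+
  have ii: "i * i = -1" using i2 by (simp add: power2_eq_square)
  have ni: "i \<noteq> t" if "t ^ q = t" for t :: 'a using i_notin that by auto
  have nz: "i - s \<noteq> 0" "i - 1 \<noteq> 0" using ni[OF sq] ni[of 1] by auto
  \<comment> \<open>These solve the linear system \<open>x + 1 = - (i / s) * y\<close>,
    \<open>y + 1 = - i * x\<close>. Since \<open>F i = -1\<close> and \<open>F\<close> is 1 on
    nonzero elements of GF(q), this realises \<open>F (x + 1) = - F y\<close> and
    \<open>F (y + 1) = - F x\<close>.\<close>
  define x y where "x = (i - s) / (s + 1)" and "y = s * (i - 1) / (s + 1)"
  have x1: "x + 1 = - (i * (i - 1)) / (s + 1)" and y1: "y + 1 = i * (s - i) / (s + 1)"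
    using s1 ii by (simp_all add: x_def y_def field_simps)
  have Fx: "F x = F (i - s)" and Fy: "F y = F (i - 1)"
    by (simp_all add: x_def y_def F_divide F_mult Fs Fs1)
  have Fx1: "F (x + 1) = - F (i - 1)" unfolding x1 by (simp add: F_divide F_mult Fs1 Fi)
  have "F (y + 1) = - F (s - i)" unfolding y1 by (simp add: F_divide F_mult Fs1 Fi)
  then have Fy1: "F (y + 1) = - F (i - s)" using F_uminus[of "i - s"] by simp
  define b where "b = F x - F y"
  \<comment> \<open>Equality would make \<open>(i - s) / (i - 1)\<close> invariant under replacing
    \<open>i\<close> by \<open>- i\<close>; cross-multiplication leaves
    \<open>2 * (i * (1 - s)) = 0\<close>, against \<open>s \<noteq> 1\<close>.\<close>
  have "F (i - s) \<noteq> F (i - 1)"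
  proof
    assume "F (i - s) = F (i - 1)"
    then have "((i - s) / (i - 1)) ^ q = (i - s) / (i - 1)" using F_eq_iff nz by blast
    then have "(- i - s) / (- i - 1) = (i - s) / (i - 1)"
      by (simp add: power_divide frob_diff iq sq)
    moreover have "- i - 1 \<noteq> 0"
    proof
      assume "- i - 1 = 0"
      then have "- i = 1" by simp
      then have "i = -1" by (metis minus_minus)
      then show False using ni[of "-1"] by (simp add: frob_uminus)
    qed
    ultimately have "(- i - s) * (i - 1) = (i - s) * (- i - 1)"
      using frac_eq_eq nz(2) by blast
    moreover have "2 * (i * (1 - s)) = (- i - s) * (i - 1) - (i - s) * (- i - 1)"
      by (simp add: algebra_simps)
    ultimately have "2 * (i * (1 - s)) = 0" by simp
    moreover have "i \<noteq> 0" using ii by force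
    ultimately show False using two_neq_0 s(2) by simp
  qed
  then have b: "b \<noteq> 0" by (simp add: b_def Fx Fy)
  \<comment> \<open>A fixed point of the reflection has \<open>x + 1 = - x\<close>, so
    \<open>F x = F (x + 1)\<close>, which puts \<open>x\<close> and then \<open>i\<close> in
    GF(q).\<close>
  have xx: "x \<noteq> - 1 - x"
  proof
    assume "x = - 1 - x"
    then have "x + 1 = - 1 - x + 1" by (rule arg_cong[where f = "\<lambda>t. t + 1"])
    then have "- x = x + 1" by simp
    then have e: "F x = F (x + 1)" using F_uminus[of x] by (simp only:)
    have "x \<noteq> 0" using nz s1 by (simp add: x_def)
    moreover from this have "x + 1 \<noteq> 0" using e by (metis F_eq_0_iff)
    ultimately have "x ^ q = x" using e subfield_of_F_eq_shift by blast
    then have "(- i - s) / (s + 1) = (i - s) / (s + 1)"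
      by (simp add: x_def power_divide frob_diff iq sq s1q)
    then have "- i - s = i - s" unfolding divide_cancel_right using s1 by blast
    then have "- i = i" by (metis diff_add_cancel)
    then show False using i_notin unfolding iq by blast
  qed
  \<comment> \<open>The reflection exchanges the two equations of the system.\<close>
  have refl1: "F (- 1 - t) = F (t + 1)" for t using F_uminus[of "t + 1"] by (simp add: algebra_simps)
  have refl2: "F (- 1 - t + 1) = F t" for t using F_uminus[of t] by simp
  have "{(x, y), (- 1 - x, - 1 - y)} \<subseteq> {(x, y). F x - F y = b \<and> F (x + 1) - F (y + 1) = b}"
    unfolding b_def insert_subset mem_Collect_eq prod.case refl1 refl2
    by (simp add: Fx Fy Fx1 Fy1)
  then have "card {(x, y), (- 1 - x, - 1 - y)} \<le> boomerang_count F 1 b"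
    unfolding boomerang_count_def by (intro card_mono) auto
  moreover have "card {(x, y), (- 1 - x, - 1 - y)} = 2" using xx by (simp add: card_insert_if)
  ultimately show ?thesis using b by auto
qed

section \<open>Upper bound: excluding zeros and the shape of solutions\<close>

text \<open>The product is 1 as well, so \<open>u\<close> is a root of t^2 - t + 1 and
  \<open>u ^ 6 = 1\<close>. As \<open>q + 1\<close> and 6 have greatest common divisor 2,
  \<open>u ^ 2 = 1\<close>; the root -1 survives only in characteristic 3.\<close>

lemma U_add_eq_one:
  assumes "\<not> [q = 2] (mod 3)" "u \<in> U" "v \<in> U" "u + v = 1"
  shows "u = -1 \<and> v = -1"
proof -
  have uv: "u * v = 1" using U_sum_mult[OF assms(2,3)] assms(4) by simp
  have v: "v = 1 - u" using assms(4) by (simp add: algebra_simps)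
  have u2: "u * u = u - 1" using uv v by (simp add: algebra_simps)
  have u3: "u ^ 3 = -1" by (simp add: power3_eq_cube u2 algebra_simps)
  have u6: "u ^ 6 = 1" using u3 power_mult[of u 3 2] by simp
  have "q mod 3 \<noteq> 2" using assms(1) by (simp add: cong_def)
  moreover have "odd q" using q_mod_4 by presburger
  ultimately have "(q + 1) mod 6 = 2 \<or> (q + 1) mod 6 = 4" by presburger
  moreover define m r where "m = (q + 1) div 6" and "r = (q + 1) mod 6"
  ultimately have qm: "q + 1 = 6 * m + r" "r = 2 \<or> r = 4"
    by simp_all
  have "u ^ (q + 1) = 1" using assms(2) by (simp add: U_def mult.commute)
  then have "u ^ r = 1" using u6 unfolding qm(1) by (simp add: power_add power_mult)
  moreover have "u ^ 2 = 1" if "u ^ 4 = 1"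
  proof -
    have "u ^ 6 = u ^ 4 * u ^ 2" by (simp flip: power_add)
    then show ?thesis unfolding u6 that by simp
  qed
  ultimately have "u ^ 2 = 1" using qm(2) by auto
  then have "u = -1" using u2 u3 by (auto simp: power2_eq_1_iff)
  then show ?thesis using v u2 uv by (metis minus_minus mult_minus1)
qed

text \<open>By \<open>U_add_eq_one\<close> one of the values would be 1 and the other -1. The value
  1 puts both \<open>x\<close> and \<open>x + 1\<close> in GF(q), where \<open>F\<close> never takes
  the value -1.\<close>

lemma F_shift_diff_one:
  assumes "\<not> [q = 2] (mod 3)" "x \<noteq> 0" "x + 1 \<noteq> 0"
  shows "F (x + 1) - F x \<noteq> 1" "F (x + 1) - F x \<noteq> -1"
proof -
  have *: False if "F s = 1" "F t = -1" "s = x \<and> t = x + 1 \<or> t = x \<and> s = x + 1" for s t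
  proof -
    have sq: "s ^ q = s" using that F_eq_1_iff by blast
    have "t ^ q = t" using that(3) sq frob[of x 1] by auto
    then have "F t = 1" using F_subfield assms that(3) by blast
    then show False using that(2) two_neq_0 by (metis add_eq_0_iff one_add_one)
  qed
  have U: "F x \<in> U" "F (x + 1) \<in> U" using F_in_U assms by auto
  show "F (x + 1) - F x \<noteq> 1"
    using U_add_eq_one[OF assms(1) U(2) U_uminus[OF U(1)]] * by auto
  show "F (x + 1) - F x \<noteq> -1"
  proof
    assume "F (x + 1) - F x = -1"
    then have "F x + - F (x + 1) = 1" by (simp add: algebra_simps)
    then have "F x = -1" "F (x + 1) = 1"
      using U_add_eq_one[OF assms(1) U(1) U_uminus[OF U(2)]] by auto
    then show False using * by blast
  qed
qed

text \<open>The differences 1 and -1 occur only at 0 and -1 respectively. So a zero among the four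
  arguments of the system forces \<open>x = y\<close>, contradicting
  \<open>b \<noteq> 0\<close>.\<close>

lemma F_shift_diff_inj:
  assumes "\<not> [q = 2] (mod 3)" "F (x + 1) - F x = F (y + 1) - F y" "x = 0 \<or> x = -1"
  shows "y = x"
proof -
  have m1: "(1::'a) \<noteq> -1" using two_neq_0 by (metis add_eq_0_iff one_add_one)
  have F0: "F (0 + 1) - F 0 = 1" "F (-1 + 1) - F (-1) = -1" by simp_all
  have "y = 0 \<or> y = -1"
    using F_shift_diff_one[OF assms(1), of y] F0 assms(2,3) by (metis add_eq_0_iff add.commute)
  then show ?thesis using F0 assms(2,3) m1 by (metis m1)
qed

lemma boomerang_solution:
  assumes "\<not> [q = 2] (mod 3)" "b \<noteq> 0" "F x - F y = b" "F (x + 1) - F (y + 1) = b"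
  shows "x \<noteq> 0" "x + 1 \<noteq> 0" "y \<noteq> 0" "F (x + 1) = - F y" "F x \<noteq> F (x + 1)"
proof -
  have D: "F (x + 1) - F x = F (y + 1) - F y"
    using assms(3,4) by (simp add: algebra_simps)
  have "x \<noteq> y" using assms by auto
  then have nz: "x \<noteq> 0" "x \<noteq> -1" "y \<noteq> 0" "y \<noteq> -1"
    using F_shift_diff_inj[OF assms(1) D] F_shift_diff_inj[OF assms(1) D[symmetric]] \<open>x \<noteq> y\<close> by blast+
  then have nz1: "x + 1 \<noteq> 0" "y + 1 \<noteq> 0" by (simp_all add: eq_neg_iff_add_eq_0)
  show "x \<noteq> 0" "x + 1 \<noteq> 0" "y \<noteq> 0" using nz nz1 by blast+
  have not_A: False if "F x = F (x + 1)"
  proof -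
    have "F y = F (y + 1)" using that D by simp
    then have "F x = 1" "F y = 1" using F_eq_1_of_eq_shift that nz nz1 by blast+
    then show False using assms(2,3) by simp
  qed
  then show "F x \<noteq> F (x + 1)" by blast
  have U: "F x \<in> U" "F (y + 1) \<in> U" "F y \<in> U" "F (x + 1) \<in> U"
    using F_in_U nz nz1 by auto
  have sum: "F x + F (y + 1) = F y + F (x + 1)" using D by (simp add: algebra_simps)
  \<comment> \<open>Both sides of \<open>sum\<close> add two elements of \<open>U\<close>; a nonzero
    sum would match \<open>F x\<close> with \<open>F y\<close>, giving \<open>b = 0\<close>, or with
    \<open>F (x + 1)\<close>, excluded by \<open>not_A\<close>.\<close>
  have "F x + F (y + 1) = 0"
  proof (rule ccontr)
    assume "F x + F (y + 1) \<noteq> 0"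
    then have "F x = F y \<or> F x = F (x + 1)"
      using U_sum_unique[OF U sum] by auto
    then show False using not_A assms(2,3) by auto
  qed
  then show "F (x + 1) = - F y" using sum by (metis add_eq_0_iff)
qed

section \<open>Upper bound: counting solutions by their values in \<open>U\<close>\<close>

lemma F_pair_inj:
  assumes "x \<noteq> 0" "x + 1 \<noteq> 0" "F x \<noteq> F (x + 1)"
    and "F x' = F x" "F (x' + 1) = F (x + 1)"
  shows "x' = x"
proof -
  define c e where "c = x' / x" and "e = (x' + 1) / (x + 1)"
  have nz: "x' \<noteq> 0" "x' + 1 \<noteq> 0" using assms F_eq_0_iff by metis+
  have c: "c ^ q = c" and e: "e ^ q = e"
    using F_eq_iff nz assms unfolding c_def e_def by blast+
  have x': "x' = c * x" and "x' + 1 = e * (x + 1)"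
    using assms by (simp_all add: c_def e_def)
  \<comment> \<open>Both \<open>c\<close> and \<open>e\<close> lie in GF(q). If they differ, so does
    \<open>x\<close> lie there, and \<open>F x = F (x + 1) = 1\<close>; if they agree, both are
    1.\<close>
  then have eq: "(c - e) * x = e - 1" by (simp add: algebra_simps)
  show ?thesis
  proof (cases "c = e")
    case True
    then show ?thesis using eq x' by simp
  next
    case False
    then have "x = (e - 1) / (c - e)" using eq by (simp add: field_simps)
    then have "x ^ q = x" using c e by (simp add: power_divide frob_diff)
    then have "F x = 1" "F (x + 1) = 1" using F_subfield assms frob[of x 1] by auto
    then show ?thesis using assms(3) by simp
  qed
qed

text \<open>Reading \<open>u - v\<close> as the sum of \<open>u\<close> and \<open>- v\<close> in
  \<open>U\<close>, the value \<open>b\<close> fixes this pair up to order, leaving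
  \<open>(u, v)\<close> and \<open>(- v, - u)\<close>.\<close>

lemma card_U_diff_le_2:
  assumes "b \<noteq> 0"
  shows "card {(u, v). u \<in> U \<and> v \<in> U \<and> u - v = b} \<le> 2" (is "card ?R \<le> 2")
proof (cases "?R = {}")
  case False
  then obtain t where "t \<in> ?R" by fast
  moreover obtain u v where "t = (u, v)" by (cases t)
  ultimately have uv: "u \<in> U" "v \<in> U" "u - v = b" by simp_all
  have "?R \<subseteq> {(u, v), (- v, - u)}"
  proof (rule subsetI)
    fix t assume "t \<in> ?R"
    moreover obtain w z where t: "t = (w, z)" by (cases t)
    ultimately have wz: "w \<in> U" "z \<in> U" "w - z = b" by simp_all
    have "w + - z = u + - v" "w + - z \<noteq> 0"
      unfolding diff_conv_add_uminus[symmetric] uv(3) wz(3) by (rule refl, rule assms)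
    then have "w = u \<and> - z = - v \<or> w = - v \<and> - z = u"
      using U_sum_unique U_uminus uv(1,2) wz(1,2) by blast
    then show "t \<in> {(u, v), (- v, - u)}" using t by auto
  qed
  then have "card ?R \<le> card {(u, v), (- v, - u)}" by (intro card_mono) auto
  also have "\<dots> \<le> 2" using card_length[of "[(u, v), (- v, - u)]"] by simp
  finally show ?thesis .
next
  case True
  show ?thesis unfolding True by simp
qed

lemma boomerang_count_le_2:
  assumes "\<not> [q = 2] (mod 3)" "b \<noteq> 0"
  shows "boomerang_count F 1 b \<le> 2"
proof -
  let ?S = "{(x, y). F x - F y = b \<and> F (x + 1) - F (y + 1) = b}"
  let ?R = "{(u, v). u \<in> U \<and> v \<in> U \<and> u - v = b}"
  note sol = boomerang_solution[OF assms]
  \<comment> \<open>Exchanging \<open>x\<close> and \<open>y\<close> solves the system for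
    \<open>- b\<close>, so facts proved for \<open>x\<close> transfer to \<open>y\<close>.\<close>
  have swap: "F y - F x = - b" "F (y + 1) - F (x + 1) = - b"
    if "F x - F y = b" "F (x + 1) - F (y + 1) = b" for x y
    using that by (metis minus_diff_eq)+
  have "card ?S \<le> card ?R"
  proof (rule card_inj_on_le)
    show "inj_on (\<lambda>(x, y). (F x, F y)) ?S"
    proof (rule inj_onI)
      fix s t assume st: "s \<in> ?S" "t \<in> ?S"
        and eq: "(\<lambda>(x, y). (F x, F y)) s = (\<lambda>(x, y). (F x, F y)) t"
      obtain x y x' y' where s1: "s = (x, y)" and t1: "t = (x', y')" by (cases s, cases t)
      have s: "F x - F y = b" "F (x + 1) - F (y + 1) = b"
        and t: "F x' - F y' = b" "F (x' + 1) - F (y' + 1) = b"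
        using st by (simp_all add: s1 t1)
      have E: "F x' = F x" "F y' = F y" using eq by (simp_all add: s1 t1)
      have E1: "F (x' + 1) = F (x + 1)" using sol(4)[OF s] sol(4)[OF t] E by simp
      have "F (x' + 1) - F (y' + 1) = F (x + 1) - F (y + 1)" unfolding s(2) t(2) ..
      then have E2: "F (y' + 1) = F (y + 1)" by (simp add: E1)
      have b': "- b \<noteq> 0" using assms by simp
      note sol' = boomerang_solution[OF assms(1) b' swap[OF s]]
      have "x' = x" using F_pair_inj[OF sol(1,2,5)[OF s] E(1) E1] .
      moreover have "y' = y" using F_pair_inj[OF sol'(1,2,5) E(2) E2] .
      ultimately show "s = t" by (simp add: s1 t1)
    qed
    show "(\<lambda>(x, y). (F x, F y)) ` ?S \<subseteq> ?R"
    proof (rule image_subsetI)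
      fix t assume st: "t \<in> ?S"
      obtain x y where t: "t = (x, y)" by (cases t)
      then have S: "F x - F y = b" "F (x + 1) - F (y + 1) = b" using st by simp_all
      show "(\<lambda>(x, y). (F x, F y)) t \<in> ?R"
        using F_in_U[OF sol(1)[OF S]] F_in_U[OF sol(3)[OF S]] S(1) by (simp add: t)
    qed
  qed simp
  also have "\<dots> \<le> 2" by (rule card_U_diff_le_2[OF assms(2)])
  finally show ?thesis by (simp add: boomerang_count_def)
qed

end

section \<open>The maximum over all shifts and differences\<close>

theorem theorem3p2:
  fixes q :: nat
  assumes "primepow q" and "odd q"
    and "\<not> [q = 2] (mod 3)" and "[q = 3] (mod 4)"
    and "q \<noteq> 3"
    and "CARD('a) = q ^ 2"
  shows "boomerang_uniformity (\<lambda>x::'a::{field,finite}. x ^ ((q - 1) * (q + 3) div 2)) = 2"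
proof -
  obtain p n where p: "prime p" "n > 0" "q = p ^ n"
    using assms(1) by (auto simp: primepow_def)
  \<comment> \<open>The characteristic divides a power of \<open>p\<close>, hence equals
    \<open>p\<close>, so raising to \<open>q = p ^ n\<close> is an iterated Frobenius map and thus
    additive.\<close>
  have "CHAR('a) > 0" by (simp add: finite_imp_CHAR_pos)
  then have char: "prime CHAR('a)" by (rule prime_CHAR_semidom)
  moreover have "CHAR('a) dvd p ^ (n * 2)"
    using CHAR_dvd_CARD[where 'a = 'a] assms(6) p(3) by (simp add: power_mult)
  ultimately have "CHAR('a) = p"
    using p(1) by (meson prime_dvd_power primes_dvd_imp_eq)
  then have "(x + y) ^ q = x ^ q + y ^ q" for x y :: 'a
    using freshmans_dream'[OF char, of q n] p(3) by simp
  then interpret quadratic_ext q "TYPE('a)"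
    using assms by unfold_locales (auto simp: cong_def)
  let ?F = "\<lambda>x::'a. x ^ ((q - 1) * (q + 3) div 2)"
  have F_eq: "?F = F" by (simp add: F_def d_def fun_eq_iff)
  let ?B = "{boomerang_count F a b | a b. a \<noteq> 0 \<and> b \<noteq> 0}"
  have fin: "finite ?B"
    by (rule finite_subset[of _ "range (\<lambda>(a, b). boomerang_count F a b)"]) auto
  have le: "boomerang_count F a b \<le> 2" if "a \<noteq> 0" "b \<noteq> 0" for a b
  proof -
    have "F = (\<lambda>x. x ^ d)" by (simp add: F_def fun_eq_iff)
    with boomerang_count_power_scale[OF that(1), of d b] that
      boomerang_count_le_2[OF assms(3), of "b / a ^ d"]
    show ?thesis by simp
  qed
  obtain b :: 'a where "b \<noteq> 0" and "2 \<le> boomerang_count F 1 b"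
    using boomerang_count_ge_2[OF assms(5)] by blast
  then have "boomerang_count F 1 b = 2" using le[of 1 b] by simp
  then have "2 \<in> ?B"
    using \<open>b \<noteq> 0\<close> by (intro CollectI exI[of _ "1::'a"] exI[of _ b]) simp
  moreover have "m \<le> 2" if "m \<in> ?B" for m using that le by auto
  ultimately have "Max ?B = 2" using fin by (intro Max_eqI) auto
  then show ?thesis unfolding boomerang_uniformity_def F_eq .
qed

end
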